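(* Let $m\in\omega$, let $\lambda<\omega_1$ be a limit ordinal, and let $\mathcal E$ be a family of infinite broom sets such that the space $X_{\mathcal E}$ is Tychonoff. Then: 1) if $\mathcal E\subset\mathcal E_m$, then $X_{\mathcal E}$ is absolutely $\mathcal F_{2m+1}$; 2) if $\mathcal E\subset\bigcup_{\beta<\lambda}\mathcal E_\beta$, then $X_{\mathcal E}$ is absolutely $\mathcal F_{\lambda+1}$; 3) if $\mathcal E\subset\mathcal E_{\lambda+m}$, then $X_{\mathcal E}$ is absolutely $\mathcal F_{\lambda+2m+3}$.
   Context: All topological spaces are Tychonoff. $\omega^{<\omega}$ is the set of finite sequences of non-negative integers, $\omega^\omega$ the set of infinite ones; $s\sqsubset t$ means that $t$ extends $s$ (equality allowed); $s\hat{\ }t$ is concatenation, $s\hat{\ }k:=s\hat{\ }(k)$ for $k\in\omega$, and $s\hat{\ }T:=\{s\hat{\ }t\mid t\in T\}$ for a set $T$ of sequences. Broom sets: $\mathcal B_0:=\{\{s\}\mid s\in\omega^{<\omega}\}$; for $1\le\alpha<\omega_1$, $\mathcal B_\alpha$ is the union of $\bigcup_{\beta<\alpha}\mathcal B_\beta$ and the collection of all sets $B\subset\omega^{<\omega}$ of the form $B=\bigcup_{n\in\omega}h\hat{\ }f_n\hat{\ }B_n$, where $h\in\omega^{<\omega}$, $B_n\in\bigcup_{\beta<\alpha}\mathcal B_\beta$ and $(f_n)_{n\in\omega}$ is a one-to-one sequence in $\omega$. $\mathcal B_{\omega_1}:=\bigcup_{\alpha<\omega_1}\mathcal B_\alpha$.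 A set $A\subset\omega^\omega$ is an infinite extension of $B\subset\omega^{<\omega}$ if there is a bijection $\varphi:B\to A$ with $\varphi(s)\sqsupset s$ for all $s\in B$. For $\alpha\le\omega_1$, $\mathcal E_\alpha:=\{E\subset\omega^\omega\mid E$ is an infinite extension of some $B\in\mathcal B_\alpha\}$; elements of $\mathcal E_{\omega_1}$ are called infinite broom sets. For a family $\mathcal E$ of countable subsets of $\omega^\omega$, $X_{\mathcal E}$ is the set $\omega^\omega\cup\{\infty\}$ with the topology in which each $\sigma\in\omega^\omega$ is isolated and the sets $\{\infty\}\cup(\omega^\omega\setminus E)$, $E\in\mathcal E$, form a neighborhood subbasis of $\infty$. $\mathcal F$-Borel classes on a space $Y$: $\mathcal F_1(Y)$ is the family of closed subsets of $Y$; for $2\le\alpha<\omega_1$ even, $\mathcal F_\alpha(Y)$ is the family of countable unions of elements of $\bigcup_{1\le\beta<\alpha}\mathcal F_\beta(Y)$; for $3\le\alpha<\omega_1$ odd, $\mathcal F_\alpha(Y)$ is the family of countable intersections of elements of $\bigcup_{1\le\beta<\alpha}\mathcal F_\beta(Y)$. (An ordinal $\lambda+n$, with $\lambda$ zero or limit and $n\in\omega$, is even/odd according to the parity of $n$.) $X$ is absolutely $\mathcal F_\alpha$ if $X\in\mathcal F_\alpha(Y)$ for every Tychonoff space $Y$ in which $X$ is densely embedded. *)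

theory Defs
  imports "HOL-Analysis.Analysis"
begin

section \<open>Countable ordinals\<close>

text \<open>An ordinal below \<open>\<omega>\<^sub>1\<close> is an isomorphism class of well-orders whose field is a set of
  natural numbers.  The type \<open>omega1\<close> is thus (order-isomorphic to) the ordinal \<open>\<omega>\<^sub>1\<close>, and
  \<open>{..<\<alpha>}\<close> is the set of ordinals below \<open>\<alpha>\<close>.\<close>

quotient_type omega1 = "nat rel" / partial: "\<lambda>r s. (r, s) \<in> ordIso"
proof (rule part_equivpI)
  have "Well_order ({} :: nat rel)"
    by (simp add: well_order_on_def linear_order_on_def partial_order_on_def
        preorder_on_def refl_on_def trans_def antisym_def total_on_def)
  then show "\<exists>r::nat rel. (r, r) \<in> ordIso"
    using ordIso_reflexive by blast
  show "symp (\<lambda>r s::nat rel. (r, s) \<in> ordIso)"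
    by (rule sympI) (rule ordIso_symmetric)
  show "transp (\<lambda>r s::nat rel. (r, s) \<in> ordIso)"
    by (rule transpI) (rule ordIso_transitive)
qed

lemma ordIso_self_iff: "(r, r) \<in> ordIso \<longleftrightarrow> Well_order r"
  using ordIso_reflexive by (auto simp: ordIso_def)

instantiation omega1 :: wellorder
begin

lift_definition less_eq_omega1 :: "omega1 \<Rightarrow> omega1 \<Rightarrow> bool" is "\<lambda>r s. (r, s) \<in> ordLeq"
  by (meson ordIso_ordLeq_trans ordIso_symmetric ordLeq_ordIso_trans)

lift_definition less_omega1 :: "omega1 \<Rightarrow> omega1 \<Rightarrow> bool" is "\<lambda>r s. (r, s) \<in> ordLess"
  by (meson ordIso_ordLess_trans ordIso_symmetric ordLess_ordIso_trans)

instance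
proof
  fix x y z :: omega1
  show "x < y \<longleftrightarrow> x \<le> y \<and> \<not> y \<le> x"
    by transfer (metis ordIso_self_iff not_ordLeq_iff_ordLess ordLess_imp_ordLeq)
  show "x \<le> x"
    by transfer (simp add: ordIso_self_iff ordLeq_reflexive)
  show "x \<le> y \<Longrightarrow> y \<le> z \<Longrightarrow> x \<le> z"
    by transfer (rule ordLeq_transitive)
  show "x \<le> y \<Longrightarrow> y \<le> x \<Longrightarrow> x = y"
    by transfer (simp add: ordIso_iff_ordLeq)
  show "x \<le> y \<or> y \<le> x"
    by transfer (metis ordIso_self_iff ordLess_or_ordLeq ordLess_imp_ordLeq)
next
  fix P :: "omega1 \<Rightarrow> bool" and a :: omega1
  assume step: "\<And>x. (\<And>y. y < x \<Longrightarrow> P y) \<Longrightarrow> P x"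
  have "wf {(x, y::omega1). x < y}"
  proof (rule wf_subset)
    show "wf (inv_image ordLess rep_omega1)"
      by (rule wf_inv_image) (rule wf_ordLess)
    show "{(x, y). x < y} \<subseteq> inv_image ordLess rep_omega1"
      by (auto simp: inv_image_def less_omega1.rep_eq)
  qed
  then show "P a"
    by (rule wf_induct_rule) (use step in auto)
qed

end

instantiation omega1 :: zero
begin

lift_definition zero_omega1 :: omega1 is "{}"
  by (simp add: ordIso_self_iff well_order_on_def linear_order_on_def partial_order_on_def
      preorder_on_def refl_on_def trans_def antisym_def total_on_def)

instance ..

end

lemma omega1_zero_le: "0 \<le> (\<alpha>::omega1)"
  by transfer (auto simp: ordIso_self_iff ordLeq_def embed_def order_on_defs refl_on_def trans_def
      antisym_def total_on_def)

text \<open>\<open>add_top r\<close> is a copy of \<open>r\<close> with a new greatest element.\<close>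

definition add_top :: "nat rel \<Rightarrow> nat rel" where
  "add_top r = {(Suc a, Suc b) | a b. (a, b) \<in> r} \<union> {(x, 0) | x. x \<in> insert 0 (Suc ` Field r)}"

lemma Field_add_top: "Field (add_top r) = insert 0 (Suc ` Field r)"
  unfolding set_eq_iff by (auto simp: add_top_def Field_def Domain_iff Range_iff image_iff)

lemma Well_order_add_top:
  assumes "Well_order r"
  shows "Well_order (add_top r)"
proof -
  have lin: "Linear_order r" and r: "refl_on (Field r) r" "trans r" "antisym r" "total_on (Field r) r"
    using assms by (auto simp: order_on_defs)
  have fld: "a \<in> Field r" "b \<in> Field r" if "(a, b) \<in> r" for a b
    using that by (auto simp: Field_def)
  have "trans (add_top r)"
    unfolding trans_def using fld r(2) by (auto simp: add_top_def dest: transD)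
  moreover have "antisym (add_top r)"
    unfolding antisym_def using r(3) by (auto simp: add_top_def dest: antisymD)
  moreover have "total_on (Field (add_top r)) (add_top r)"
    unfolding Field_add_top using r(4) by (auto simp: total_on_def add_top_def)
  moreover have "refl_on (Field (add_top r)) (add_top r)"
    unfolding Field_add_top using r(1) by (auto simp: refl_on_def add_top_def)
  ultimately have lin': "Linear_order (add_top r)"
    by (auto simp: order_on_defs Field_def)
  show ?thesis
  proof (subst Linear_order_Well_order_iff[OF lin'], intro allI impI)
    fix A
    assume A: "A \<subseteq> Field (add_top r)" "A \<noteq> {}"
    show "\<exists>a\<in>A. \<forall>a'\<in>A. (a, a') \<in> add_top r"
    proof (cases "A = {0}")
      case True
      then show ?thesis by (auto simp: add_top_def)
    next
      case False
      let ?B = "{a. Suc a \<in> A}"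
      have "?B \<subseteq> Field r" "?B \<noteq> {}"
        using A False by (auto simp: Field_add_top)
      then obtain b where b: "b \<in> ?B" "\<forall>b'\<in>?B. (b, b') \<in> r"
        using assms Linear_order_Well_order_iff[OF lin] by blast
      have "(Suc b, a') \<in> add_top r" if "a' \<in> A" for a'
      proof (cases a')
        case 0
        then show ?thesis using b \<open>?B \<subseteq> Field r\<close> by (auto simp: add_top_def)
      next
        case (Suc c)
        then have "(b, c) \<in> r" using b(2) that by auto
        then show ?thesis using Suc by (auto simp: add_top_def)
      qed
      with b(1) show ?thesis by blast
    qed
  qed
qed

lemma ordLess_add_top:
  assumes "Well_order r"
  shows "(r, add_top r) \<in> ordLess"
proof -
  have eq: "Restr (add_top r) (Suc ` Field r) = dir_image r Suc"
    by (auto simp: add_top_def dir_image_def Field_def)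
  have "ofilter (add_top r) (Suc ` Field r)"
    by (auto simp: ofilter_def under_def Field_add_top) (auto simp: add_top_def Field_def)
  then have "(Restr (add_top r) (Suc ` Field r), add_top r) \<in> ordLess"
    using ofilter_ordLess[OF Well_order_add_top[OF assms]] by (auto simp: Field_add_top)
  moreover have "(r, dir_image r Suc) \<in> ordIso"
    by (rule dir_image_ordIso) (auto simp: assms)
  ultimately show ?thesis
    unfolding eq by (rule ordIso_ordLess_trans[rotated])
qed

lemma omega1_no_top: "\<exists>\<beta>. (\<alpha>::omega1) < \<beta>"
proof (transfer, unfold ordIso_self_iff)
  fix r :: "nat rel"
  assume r: "Well_order r"
  show "\<exists>s::nat rel\<in>{x. Well_order x}. (r, s) \<in> ordLess"
    by (rule bexI[of _ "add_top r"]) (simp_all add: r Well_order_add_top ordLess_add_top)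
qed

definition osuc :: "omega1 \<Rightarrow> omega1" where
  "osuc \<alpha> = (LEAST \<beta>. \<alpha> < \<beta>)"

lemma less_osuc: "\<alpha> < osuc \<alpha>"
  unfolding osuc_def by (rule LeastI_ex) (rule omega1_no_top)

lemma osuc_le_iff: "osuc \<alpha> \<le> \<beta> \<longleftrightarrow> \<alpha> < \<beta>"
  using less_osuc[of \<alpha>] by (auto simp: osuc_def intro: Least_le)

text \<open>The ordinal sum \<open>\<alpha> + n\<close> for a natural number \<open>n\<close>; in particular \<open>oplus 0 n\<close> is the finite
  ordinal \<open>n\<close>.\<close>

definition oplus :: "omega1 \<Rightarrow> nat \<Rightarrow> omega1" (infixl "\<oplus>\<^sub>o" 65) where
  "\<alpha> \<oplus>\<^sub>o n = (osuc ^^ n) \<alpha>"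

definition limit_ord :: "omega1 \<Rightarrow> bool" where
  "limit_ord \<alpha> \<longleftrightarrow> \<alpha> \<noteq> 0 \<and> (\<forall>\<beta>. \<alpha> \<noteq> osuc \<beta>)"

definition even_ord :: "omega1 \<Rightarrow> bool" where
  "even_ord \<alpha> \<longleftrightarrow> (\<exists>\<mu> n. (\<mu> = 0 \<or> limit_ord \<mu>) \<and> \<alpha> = \<mu> \<oplus>\<^sub>o n \<and> even n)"

definition odd_ord :: "omega1 \<Rightarrow> bool" where
  "odd_ord \<alpha> \<longleftrightarrow> (\<exists>\<mu> n. (\<mu> = 0 \<or> limit_ord \<mu>) \<and> \<alpha> = \<mu> \<oplus>\<^sub>o n \<and> odd n)"

lemma even_or_odd_ord: "even_ord \<alpha> \<or> odd_ord \<alpha>"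
proof (induction \<alpha> rule: less_induct)
  case (less \<alpha>)
  show ?case
  proof (cases "\<alpha> = 0 \<or> limit_ord \<alpha>")
    case True
    then have "even_ord \<alpha>"
      unfolding even_ord_def by (intro exI[of _ \<alpha>] exI[of _ 0]) (simp add: oplus_def)
    then show ?thesis ..
  next
    case False
    then obtain \<beta> where \<beta>: "\<alpha> = osuc \<beta>"
      by (auto simp: limit_ord_def)
    have suc: "osuc (\<mu> \<oplus>\<^sub>o n) = \<mu> \<oplus>\<^sub>o Suc n" for \<mu> n
      by (simp add: oplus_def)
    from less[of \<beta>] less_osuc[of \<beta>] have "even_ord \<beta> \<or> odd_ord \<beta>"
      by (simp add: \<beta>)
    then show ?thesis
      unfolding \<beta> even_ord_def odd_ord_def using suc by (metis even_Suc)
  qed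
qed

lemma osuc_inj: "osuc \<alpha> = osuc \<beta> \<longleftrightarrow> \<alpha> = \<beta>"
  by (metis less_osuc linorder_neqE osuc_le_iff leD)

lemma not_even_and_odd_ord: "\<not> (even_ord \<alpha> \<and> odd_ord \<alpha>)"
proof -
  have nosuc: "\<mu> \<noteq> osuc \<beta>" if "\<mu> = 0 \<or> limit_ord \<mu>" for \<mu> \<beta>
    using that less_osuc[of \<beta>] omega1_zero_le[of \<beta>] by (auto simp: limit_ord_def)
  have "m = n" if "\<mu> = 0 \<or> limit_ord \<mu>" "\<nu> = 0 \<or> limit_ord \<nu>" "\<mu> \<oplus>\<^sub>o m = \<nu> \<oplus>\<^sub>o n" for \<mu> \<nu> m n
    using that(3)
  proof (induction m arbitrary: n)
    case 0
    then show ?case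
      using nosuc[OF that(1)] by (cases n) (auto simp: oplus_def)
  next
    case (Suc m)
    then show ?case
      using nosuc[OF that(2)] by (cases n) (auto simp: oplus_def osuc_inj dest: sym)
  qed
  then show ?thesis
    unfolding even_ord_def odd_ord_def by metis
qed


section \<open>Broom sets\<close>

text \<open>Finite sequences are lists, infinite sequences are functions on \<open>nat\<close>.\<close>

function broom :: "omega1 \<Rightarrow> nat list set set" where
  "broom \<alpha> =
     (if \<alpha> = 0 then {{s} | s. True}
      else (\<Union>\<beta>\<in>{..<\<alpha>}. broom \<beta>) \<union>
        {(\<Union>n::nat. (\<lambda>t. h @ [f n] @ t) ` B n) | h (f :: nat \<Rightarrow> nat) B.
           inj f \<and> range B \<subseteq> (\<Union>\<beta>\<in>{..<\<alpha>}. broom \<beta>)})"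
  by auto
termination
  by (relation "{(x, y). x < y}") (auto simp: wf)

declare broom.simps [simp del]

definition infinite_extension :: "(nat \<Rightarrow> nat) set \<Rightarrow> nat list set \<Rightarrow> bool" where
  "infinite_extension A B \<longleftrightarrow>
     (\<exists>\<phi>. bij_betw \<phi> B A \<and> (\<forall>s\<in>B. \<forall>i<length s. \<phi> s i = s ! i))"

definition broom_ext :: "omega1 \<Rightarrow> (nat \<Rightarrow> nat) set set" where
  "broom_ext \<alpha> = {E. \<exists>B\<in>broom \<alpha>. infinite_extension E B}"

text \<open>The class with index \<open>\<omega>\<^sub>1\<close>.\<close>

definition infinite_broom_sets :: "(nat \<Rightarrow> nat) set set" where
  "infinite_broom_sets = {E. \<exists>B\<in>(\<Union>\<alpha>. broom \<alpha>). infinite_extension E B}"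


section \<open>The space of a family of sets of sequences\<close>

text \<open>\<open>None\<close> is the point at infinity.  Since the sequences are isolated, a set
  \<open>{\<infinity>} \<union> (\<omega>\<^sup>\<omega> - E)\<close> is a neighbourhood of \<open>\<infinity>\<close> iff it is open.  \<open>UNIV\<close> only matters when
  \<open>\<E>\<close> is empty.\<close>

definition broom_space :: "(nat \<Rightarrow> nat) set set \<Rightarrow> (nat \<Rightarrow> nat) option topology" where
  "broom_space \<E> = topology_generated_by
     ({UNIV} \<union> range (\<lambda>\<sigma>. {Some \<sigma>}) \<union> (\<lambda>E. {None} \<union> Some ` (UNIV - E)) ` \<E>)"

lemma topspace_broom_space: "topspace (broom_space \<E>) = UNIV"
  by (simp add: broom_space_def topology_generated_by_topspace)

lemma openin_broom_space_singleton: "openin (broom_space \<E>) {Some \<sigma>}"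
  unfolding broom_space_def by (rule topology_generated_by_Basis) auto

lemma openin_broom_space_iff:
  "openin (broom_space \<E>) U \<longleftrightarrow>
     (None \<in> U \<longrightarrow> (\<exists>\<F>. finite \<F> \<and> \<F> \<subseteq> \<E> \<and> {None} \<union> Some ` (UNIV - \<Union>\<F>) \<subseteq> U))"
proof
  let ?N = "\<lambda>U. None \<in> U \<longrightarrow> (\<exists>\<F>. finite \<F> \<and> \<F> \<subseteq> \<E> \<and> {None} \<union> Some ` (UNIV - \<Union>\<F>) \<subseteq> U)"
  assume "openin (broom_space \<E>) U"
  then have "generate_topology_on
     ({UNIV} \<union> range (\<lambda>\<sigma>. {Some \<sigma>}) \<union> (\<lambda>E. {None} \<union> Some ` (UNIV - E)) ` \<E>) U"
    by (simp add: broom_space_def openin_topology_generated_by_iff)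
  then show "?N U"
  proof induction
    case Empty
    show ?case by simp
  next
    case (Int a b)
    show ?case
    proof
      assume "None \<in> a \<inter> b"
      with Int obtain F G where
        "finite F" "F \<subseteq> \<E>" "{None} \<union> Some ` (UNIV - \<Union>F) \<subseteq> a"
        "finite G" "G \<subseteq> \<E>" "{None} \<union> Some ` (UNIV - \<Union>G) \<subseteq> b"
        by auto
      then show "\<exists>\<F>. finite \<F> \<and> \<F> \<subseteq> \<E> \<and> {None} \<union> Some ` (UNIV - \<Union>\<F>) \<subseteq> a \<inter> b"
        by (intro exI[of _ "F \<union> G"]) auto
    qed
  next
    case (UN K)
    then show ?case by (meson Union_iff Union_upper order_trans)
  next
    case (Basis s)
    then consider "s = UNIV" | \<sigma> where "s = {Some \<sigma>}"
      | E where "E \<in> \<E>" "s = {None} \<union> Some ` (UNIV - E)"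
      by blast
    then show ?case
    proof cases
      case 1
      then show ?thesis by (intro impI exI[of _ "{}"]) auto
    next
      case 2
      then show ?thesis by simp
    next
      case 3
      then show ?thesis by (intro impI exI[of _ "{E}"]) auto
    qed
  qed
next
  assume *: "None \<in> U \<longrightarrow> (\<exists>\<F>. finite \<F> \<and> \<F> \<subseteq> \<E> \<and> {None} \<union> Some ` (UNIV - \<Union>\<F>) \<subseteq> U)"
  have "\<exists>T. openin (broom_space \<E>) T \<and> x \<in> T \<and> T \<subseteq> U" if "x \<in> U" for x
  proof (cases x)
    case (Some \<sigma>)
    then show ?thesis using openin_broom_space_singleton that by blast
  next
    case None
    with * that obtain F where F: "finite F" "F \<subseteq> \<E>" "{None} \<union> Some ` (UNIV - \<Union>F) \<subseteq> U"
      by auto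
    have basic: "openin (broom_space \<E>) ({None} \<union> Some ` (UNIV - E))" if "E \<in> \<E>" for E
      unfolding broom_space_def using that by (intro topology_generated_by_Basis) auto
    have basic_UNIV: "openin (broom_space \<E>) UNIV"
      using openin_topspace[of "broom_space \<E>"] by (simp add: topspace_broom_space)
    have top: "{None} \<union> Some ` (UNIV - \<Union>{}) = (UNIV :: (nat \<Rightarrow> nat) option set)"
      by (simp add: UNIV_option_conv)
    have ins: "{None} \<union> Some ` (UNIV - \<Union>(insert E G)) =
        ({None} \<union> Some ` (UNIV - E)) \<inter> ({None} \<union> Some ` (UNIV - \<Union>G))" for E :: "(nat \<Rightarrow> nat) set" and G
      by blast
    from F(1,2) have "openin (broom_space \<E>) ({None} \<union> Some ` (UNIV - \<Union>F))"
    proof (induction F rule: finite_induct)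
      case empty
      show ?case unfolding top by (rule basic_UNIV)
    next
      case (insert E G)
      then have "E \<in> \<E>" "G \<subseteq> \<E>" by simp_all
      then show ?case
        unfolding ins using basic insert.IH by (intro openin_Int) simp_all
    qed
    then show ?thesis
      using F(3) None by blast
  qed
  then show "openin (broom_space \<E>) U"
    by (subst openin_subopen) blast
qed


section \<open>Tychonoff spaces and \<open>\<F>\<close>-Borel classes\<close>

text \<open>\<open>completely_regular_space\<close> does not include any separation of points.\<close>

definition tychonoff_space :: "'a topology \<Rightarrow> bool" where
  "tychonoff_space X \<longleftrightarrow> completely_regular_space X \<and> Hausdorff_space X"

text \<open>The value at \<open>0\<close> is a dummy; the classes are indexed by ordinals \<open>\<ge> 1\<close>.\<close>

function F_Borel :: "'a topology \<Rightarrow> omega1 \<Rightarrow> 'a set set" where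
  "F_Borel Y \<alpha> =
     (if \<alpha> = 0 then {}
      else if \<alpha> = 0 \<oplus>\<^sub>o 1 then {C. closedin Y C}
      else if even_ord \<alpha> then
        {(\<Union>n. A n) | A :: nat \<Rightarrow> 'a set. range A \<subseteq> (\<Union>\<beta>\<in>{0 \<oplus>\<^sub>o 1..<\<alpha>}. F_Borel Y \<beta>)}
      else
        {(\<Inter>n. A n) | A :: nat \<Rightarrow> 'a set. range A \<subseteq> (\<Union>\<beta>\<in>{0 \<oplus>\<^sub>o 1..<\<alpha>}. F_Borel Y \<beta>)})"
  by auto
termination
  by (relation "inv_image {(x, y). x < y} snd") (auto simp: wf)

declare F_Borel.simps [simp del]

text \<open>A definition cannot quantify over types, so the type of the points of the ambient spaces
  \<open>Y\<close> is a parameter; a statement polymorphic in this type ranges over all spaces \<open>Y\<close>.\<close>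

definition absolutely_F :: "'b itself \<Rightarrow> 'a topology \<Rightarrow> omega1 \<Rightarrow> bool" where
  "absolutely_F _ X \<alpha> \<longleftrightarrow>
     (\<forall>(Y :: 'b topology) e.
        tychonoff_space Y \<and> embedding_map X Y e \<and>
        Y closure_of (e ` topspace X) = topspace Y \<longrightarrow>
        e ` topspace X \<in> F_Borel Y \<alpha>)"

end

theory Submission
  imports Defs
begin

text \<open>Let \<open>C(s)\<close> be the closure in \<open>Y\<close> of the cylinder of \<open>s\<close>, together with \<open>\<infinity>\<close>.  Iterating
  \<open>Z\<^sub>\<alpha>(s) = C(s) \<inter> \<Inter>\<^bsub>0<\<beta><\<alpha>\<^esub> \<Inter>\<^sub>k \<Union>\<^bsub>|u|\<ge>k\<^esub> Z\<^sub>\<beta>(s u)\<close> gives \<open>\<F>\<close>-Borel sets containing the points of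
  \<open>X\<close> in the cylinder.  If \<open>\<E>\<close> consists of brooms of rank below \<open>\<alpha>\<close>, then \<open>Z\<^sub>\<alpha>(\<langle>\<rangle>) = X\<close>: a point
  \<open>y \<noteq> \<infinity>\<close> has a neighbourhood whose trace on \<open>\<omega>\<^sup>\<omega>\<close> is covered by finitely many brooms, and
  intersecting a broom with the cylinder of a sequence longer than its handle lowers its rank.
  Descending in this way, \<open>y\<close> ends up in the closure of a finite subset of \<open>\<omega>\<^sup>\<omega>\<close>.\<close>

section \<open>Ordinal arithmetic below \<open>\<omega>\<^sub>1\<close>\<close>

lemma oplus_0 [simp]: "\<alpha> \<oplus>\<^sub>o 0 = \<alpha>"
  by (simp add: oplus_def)

lemma oplus_Suc: "\<alpha> \<oplus>\<^sub>o Suc n = osuc (\<alpha> \<oplus>\<^sub>o n)"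
  by (simp add: oplus_def)

lemma less_osuc_iff: "\<alpha> < osuc \<beta> \<longleftrightarrow> \<alpha> \<le> \<beta>"
  using osuc_le_iff[of \<beta> \<alpha>] by (metis not_le)

lemma oplus_strict_mono: "m < n \<Longrightarrow> \<alpha> \<oplus>\<^sub>o m < \<alpha> \<oplus>\<^sub>o n"
  by (rule lift_Suc_mono_less[of "\<lambda>n. \<alpha> \<oplus>\<^sub>o n"]) (simp add: oplus_Suc less_osuc)

lemma le_oplus: "\<alpha> \<le> \<alpha> \<oplus>\<^sub>o n"
  using oplus_strict_mono[of 0 n \<alpha>] by (cases n) auto

lemma one_le_iff: "0 \<oplus>\<^sub>o 1 \<le> \<alpha> \<longleftrightarrow> 0 < \<alpha>"
  by (simp add: oplus_Suc osuc_le_iff)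

text \<open>A limit is closed under successors, so the finite increases of the Borel index at levels
  below a limit never reach it.\<close>

lemma limit_ord_oplus_less:
  assumes "limit_ord \<mu>" "\<beta> < \<mu>"
  shows "\<beta> \<oplus>\<^sub>o n < \<mu>"
proof (induction n)
  case (Suc n)
  then have "osuc (\<beta> \<oplus>\<^sub>o n) \<le> \<mu>"
    by (simp add: osuc_le_iff)
  moreover have "osuc (\<beta> \<oplus>\<^sub>o n) \<noteq> \<mu>"
    using assms(1) by (auto simp: limit_ord_def)
  ultimately show ?case
    by (simp add: oplus_Suc)
qed (use assms in simp)

lemma less_oplus_cases:
  assumes "\<beta> < \<mu> \<oplus>\<^sub>o n"
  obtains "\<beta> < \<mu>" | j where "j < n" "\<beta> = \<mu> \<oplus>\<^sub>o j"
proof -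
  have "\<beta> < \<mu> \<or> (\<exists>j<n. \<beta> = \<mu> \<oplus>\<^sub>o j)"
    using assms
  proof (induction n)
    case (Suc n)
    have "\<beta> \<le> \<mu> \<oplus>\<^sub>o n"
      using Suc.prems by (simp only: oplus_Suc less_osuc_iff)
    then show ?case
      using Suc.IH less_Suc_eq le_less by metis
  qed simp
  then show thesis
    using that by blast
qed

lemma ord_decompose:
  obtains \<mu> n where "\<mu> = 0 \<or> limit_ord \<mu>" "\<alpha> = \<mu> \<oplus>\<^sub>o n"
  using even_or_odd_ord[of \<alpha>] that unfolding even_ord_def odd_ord_def by metis

text \<open>An ordinal below \<alpha> is represented by a proper initial segment
  \<open>underS r a\<close> of a well-order \<open>r\<close> on naturals, and there are only
  countably many \<open>a\<close>. This makes the intersection over \<beta> in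
  \<open>tree_hull\<close> countable.\<close>

lemma countable_below: "countable {..<\<alpha>::omega1}"
proof -
  define r where "r = rep_omega1 \<alpha>"
  have r: "Well_order r" and \<alpha>: "\<alpha> = abs_omega1 r"
    using Quotient_rep_reflp[OF Quotient_omega1, of \<alpha>] Quotient_abs_rep[OF Quotient_omega1, of \<alpha>]
    by (simp_all add: r_def ordIso_self_iff)
  have "{..<\<alpha>} \<subseteq> range (\<lambda>a. abs_omega1 (Restr r (underS r a)))"
  proof
    fix \<beta> assume "\<beta> \<in> {..<\<alpha>}"
    then have "(rep_omega1 \<beta>, r) \<in> ordLess"
      by (simp add: less_omega1.rep_eq r_def)
    then obtain a where "(rep_omega1 \<beta>, Restr r (underS r a)) \<in> ordIso"
      using ordLess_iff_ordIso_Restr[OF r] by (auto simp: ordLess_def)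
    then have "abs_omega1 (rep_omega1 \<beta>) = abs_omega1 (Restr r (underS r a))"
      by (rule Quotient_rel_abs[OF Quotient_omega1])
    then show "\<beta> \<in> range (\<lambda>a. abs_omega1 (Restr r (underS r a)))"
      using Quotient_abs_rep[OF Quotient_omega1, of \<beta>] by auto
  qed
  then show ?thesis
    by (rule countable_subset) simp
qed


section \<open>Broom sets and cylinders\<close>

definition cylinder :: "nat list \<Rightarrow> (nat \<Rightarrow> nat) set" where
  "cylinder s = {\<sigma>. \<forall>i<length s. \<sigma> i = s ! i}"

lemma cylinder_append_subset: "cylinder (s @ u) \<subseteq> cylinder s"
  by (auto simp: cylinder_def nth_append)

text \<open>Lengthening \<open>s\<close> along \<sigma> itself supplies the long extensions
  \<open>u\<close> that \<open>tree_hull\<close> asks for.\<close>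

lemma cylinder_append_map: "\<sigma> \<in> cylinder s \<Longrightarrow> \<sigma> \<in> cylinder (s @ map \<sigma> [length s..<length s + k])"
  by (auto simp: cylinder_def nth_append)

lemma broom_0: "broom 0 = {{s} | s. True}"
  by (simp add: broom.simps)

lemma broom_mono: "\<beta> \<le> \<alpha> \<Longrightarrow> broom \<beta> \<subseteq> broom \<alpha>"
proof (cases "\<beta> = \<alpha>")
  case False
  assume "\<beta> \<le> \<alpha>"
  with False have "\<beta> < \<alpha>" "\<alpha> \<noteq> 0"
    using omega1_zero_le[of \<beta>] by auto
  then show ?thesis
    by (subst (2) broom.simps) auto
qed simp

lemma broom_ext_mono: "\<beta> \<le> \<alpha> \<Longrightarrow> broom_ext \<beta> \<subseteq> broom_ext \<alpha>"
  using broom_mono by (fastforce simp: broom_ext_def)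

lemma broom_cases:
  assumes "B \<in> broom \<alpha>" "\<alpha> \<noteq> 0"
  obtains \<beta> where "\<beta> < \<alpha>" "B \<in> broom \<beta>"
  | h f C where "inj f" "B = (\<Union>n::nat. (\<lambda>t. h @ [f n] @ t) ` C n)"
      "\<And>n. \<exists>\<beta><\<alpha>. C n \<in> broom \<beta>"
proof -
  have "B \<in> (\<Union>\<beta>\<in>{..<\<alpha>}. broom \<beta>) \<or>
      (\<exists>h f C. B = (\<Union>n::nat. (\<lambda>t. h @ [f n] @ t) ` C n) \<and>
        inj f \<and> range C \<subseteq> (\<Union>\<beta>\<in>{..<\<alpha>}. broom \<beta>))"
    using assms by (subst (asm) broom.simps) auto
  then show thesis
  proof (elim disjE exE conjE)
    assume "B \<in> (\<Union>\<beta>\<in>{..<\<alpha>}. broom \<beta>)"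
    then show thesis using that(1) by blast
  next
    fix h f C
    assume "B = (\<Union>n::nat. (\<lambda>t. h @ [f n] @ t) ` C n)" "inj f" "range C \<subseteq> (\<Union>\<beta>\<in>{..<\<alpha>}. broom \<beta>)"
    then show thesis using that(2)[of f h C] by (metis UN_E lessThan_iff rangeI subsetD)
  qed
qed

lemma broomI:
  assumes "B = (\<Union>n::nat. (\<lambda>t. h @ [f n] @ t) ` C n)" "inj f"
    and "range C \<subseteq> (\<Union>\<beta>\<in>{..<\<alpha>}. broom \<beta>)"
  shows "B \<in> broom \<alpha>"
proof -
  \<comment> \<open>\<open>C 0\<close> has to lie in some class strictly below \<alpha>.\<close>
  have "\<alpha> \<noteq> 0"
    using assms(3) omega1_zero_le by (metis UNIV_I UN_E image_subset_iff leD lessThan_iff)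
  then have "broom \<alpha> = (\<Union>\<beta>\<in>{..<\<alpha>}. broom \<beta>) \<union>
      {(\<Union>n::nat. (\<lambda>t. h @ [f n] @ t) ` B n) | h (f :: nat \<Rightarrow> nat) B.
        inj f \<and> range B \<subseteq> (\<Union>\<beta>\<in>{..<\<alpha>}. broom \<beta>)}"
    by (subst broom.simps) (simp only: if_False)
  with assms show ?thesis
    by blast
qed

lemma broom_prefix: "B \<in> broom \<alpha> \<Longrightarrow> (@) g ` B \<in> broom \<alpha>"
proof (induction \<alpha> arbitrary: B rule: less_induct)
  case (less \<alpha>)
  show ?case
  proof (cases "\<alpha> = 0")
    case True
    with less.prems show ?thesis by (auto simp: broom_0)
  next
    case False
    from less.prems False show ?thesis
    proof (cases rule: broom_cases)
      case (1 \<beta>)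
      then show ?thesis
        using less.IH[of \<beta> B] broom_mono[of \<beta> \<alpha>] by (meson less_imp_le subsetD)
    next
      case (2 h f C)
      have "(@) g ` B = (\<Union>n::nat. (\<lambda>t. (g @ h) @ [f n] @ t) ` C n)"
        unfolding 2(2) by (auto simp: image_UN image_image)
      moreover have "range C \<subseteq> (\<Union>\<beta>\<in>{..<\<alpha>}. broom \<beta>)"
        using 2(3) by auto
      ultimately show ?thesis
        using 2(1) by (intro broomI[of _ "g @ h" f C])
    qed
  qed
qed

text \<open>Brooms of rank 0 are singletons; finiteness is what the end of the descent in rank
  uses.\<close>

lemma broom_ext_0_finite: "E \<in> broom_ext 0 \<Longrightarrow> finite E"
  by (auto simp: broom_ext_def broom_0 infinite_extension_def bij_betw_def)

lemma infinite_extension_image: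
  assumes "bij_betw \<phi> B E" "\<forall>s\<in>B. \<phi> s \<in> cylinder s" "B' \<subseteq> B"
  shows "infinite_extension (\<phi> ` B') B'"
  unfolding infinite_extension_def
  by (rule exI[of _ \<phi>])
    (use assms in \<open>auto simp: bij_betw_def cylinder_def intro: inj_on_subset\<close>)

text \<open>A sufficiently long \<open>t\<close> selects at most one bristle of the broom.\<close>

lemma broom_ext_cylinder:
  assumes "E \<in> broom_ext \<beta>" "0 < \<beta>"
  obtains k where "\<And>t. k \<le> length t \<Longrightarrow> \<exists>\<gamma><\<beta>. \<exists>E'\<in>broom_ext \<gamma>. E \<inter> cylinder t \<subseteq> E'"
proof -
  obtain B \<phi> where B: "B \<in> broom \<beta>" and \<phi>: "bij_betw \<phi> B E" "\<forall>s\<in>B. \<phi> s \<in> cylinder s"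
    using assms(1) by (auto simp: broom_ext_def infinite_extension_def cylinder_def)
  have "\<beta> \<noteq> 0" using assms(2) by simp
  with B show thesis
  proof (cases rule: broom_cases)
    \<comment> \<open>Here \<open>B\<close> already has smaller rank, so \<open>E\<close> itself
      serves as \<open>E'\<close> and \<open>t\<close> may have any length.\<close>
    case (1 \<gamma>)
    moreover have "infinite_extension E B"
      using infinite_extension_image[OF \<phi> order_refl] \<phi>(1) by (simp add: bij_betw_def)
    ultimately show thesis
      using that[of 0] by (auto simp: broom_ext_def)
  next
    case (2 h f C)
    define B' where "B' n = (@) (h @ [f n]) ` C n" for n
    have B: "B = (\<Union>n. B' n)"
      by (simp add: 2(2) B'_def)
    have ext: "\<exists>\<gamma><\<beta>. \<phi> ` B' n \<in> broom_ext \<gamma>" for n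
    proof -
      obtain \<gamma> where "\<gamma> < \<beta>" "C n \<in> broom \<gamma>"
        using 2(3) by blast
      moreover have "infinite_extension (\<phi> ` B' n) (B' n)"
        by (rule infinite_extension_image[OF \<phi>]) (auto simp: B)
      ultimately show ?thesis
        using broom_prefix[of "C n" \<gamma> "h @ [f n]"] by (auto simp: broom_ext_def B'_def)
    qed
    \<comment> \<open>The entry at position \<open>length h\<close> identifies the bristle, because
      \<open>f\<close> is injective.\<close>
    have at: "\<sigma> (length h) = f n" if \<sigma>: "\<sigma> \<in> \<phi> ` B' n" for \<sigma> n
    proof -
      obtain t where t: "h @ [f n] @ t \<in> B' n" "\<sigma> = \<phi> (h @ [f n] @ t)"
        using \<sigma> by (auto simp: B'_def)
      then have "h @ [f n] @ t \<in> B"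
        unfolding B by blast
      with t(2) \<phi>(2) have "\<sigma> \<in> cylinder (h @ [f n] @ t)" by blast
      then show ?thesis by (auto simp: cylinder_def nth_append dest!: spec[of _ "length h"])
    qed
    have E: "E = (\<Union>n. \<phi> ` B' n)"
      using \<phi>(1) by (auto simp: bij_betw_def B)
    show thesis
    proof (rule that[of "Suc (length h)"])
      fix t :: "nat list"
      assume t: "Suc (length h) \<le> length t"
      \<comment> \<open>The length of \<open>t\<close> guarantees that this entry exists. If it is
        not a value of \<open>f\<close>, then \<open>n\<close> is a default and
        \<open>E \<inter> cylinder t\<close> is empty.\<close>
      define n where "n = inv f (t ! length h)"
      have "E \<inter> cylinder t \<subseteq> \<phi> ` B' n"
      proof
        fix \<sigma> assume \<sigma>: "\<sigma> \<in> E \<inter> cylinder t"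
        then obtain j where j: "\<sigma> \<in> \<phi> ` B' j" using E by auto
        have "f j = t ! length h"
          using at[OF j] \<sigma> t by (auto simp: cylinder_def)
        then have "j = n" using 2(1) by (simp add: n_def flip: \<open>f j = _\<close>)
        with j show "\<sigma> \<in> \<phi> ` B' n" by simp
      qed
      with ext[of n] show "\<exists>\<gamma><\<beta>. \<exists>E'\<in>broom_ext \<gamma>. E \<inter> cylinder t \<subseteq> E'" by blast
    qed
  qed
qed


section \<open>\<open>\<F>\<close>-Borel hulls\<close>

text \<open>Each step below \<open>\<alpha>\<close> applies one countable union and one countable intersection, and limit
  steps only intersect.\<close>

function tree_hull :: "(nat list \<Rightarrow> 'b set) \<Rightarrow> omega1 \<Rightarrow> nat list \<Rightarrow> 'b set" where
  "tree_hull C \<alpha> s = C s \<inter> (\<Inter>\<beta>\<in>{0<..<\<alpha>}. \<Inter>k. \<Union>u\<in>{u. k \<le> length u}. tree_hull C \<beta> (s @ u))"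
  by auto
termination
  by (relation "inv_image {(x, y). x < y} (fst \<circ> snd)") (auto simp: wf)

declare tree_hull.simps [simp del]

lemma F_Borel_closed: "closedin Y C \<Longrightarrow> C \<in> F_Borel Y (0 \<oplus>\<^sub>o 1)"
  by (subst F_Borel.simps) (auto simp: oplus_Suc less_osuc[THEN less_imp_neq, symmetric])

lemma odd_ord_1: "odd_ord (0 \<oplus>\<^sub>o 1)"
  unfolding odd_ord_def by (intro exI[of _ 0] exI[of _ 1]) simp

text \<open>Replaces the sequences of the definition by countable families. Since index 1 is odd, an
  even \<gamma> falls under the union clause.\<close>

lemma F_Borel_Union:
  assumes "even_ord \<gamma>" "countable \<A>" "\<A> \<noteq> {}"
    and \<A>: "\<And>A. A \<in> \<A> \<Longrightarrow> \<exists>\<beta>. 0 < \<beta> \<and> \<beta> < \<gamma> \<and> A \<in> F_Borel Y \<beta>"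
  shows "\<Union>\<A> \<in> F_Borel Y \<gamma>"
proof -
  have "\<gamma> \<noteq> 0"
    using assms(3) \<A> omega1_zero_le by (metis ex_in_conv leD)
  moreover have "\<gamma> \<noteq> 0 \<oplus>\<^sub>o 1"
    using assms(1) not_even_and_odd_ord odd_ord_1 by metis
  ultimately have eq: "F_Borel Y \<gamma> =
      {(\<Union>n. A n) | A :: nat \<Rightarrow> 'a set. range A \<subseteq> (\<Union>\<beta>\<in>{0 \<oplus>\<^sub>o 1..<\<gamma>}. F_Borel Y \<beta>)}"
    using assms(1) by (subst F_Borel.simps) (simp only: if_False if_True)
  obtain A :: "nat \<Rightarrow> 'a set" where A: "\<A> = range A"
    using range_from_nat_into[OF assms(3,2)] by metis
  have "range A \<subseteq> (\<Union>\<beta>\<in>{0 \<oplus>\<^sub>o 1..<\<gamma>}. F_Borel Y \<beta>)"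
  proof
    fix B assume "B \<in> range A"
    then obtain \<beta> where "0 < \<beta>" "\<beta> < \<gamma>" "B \<in> F_Borel Y \<beta>"
      using \<A>[of B] unfolding A by auto
    then show "B \<in> (\<Union>\<beta>\<in>{0 \<oplus>\<^sub>o 1..<\<gamma>}. F_Borel Y \<beta>)"
      by (intro UN_I[of \<beta>]) (simp_all only: atLeastLessThan_iff one_le_iff simp_thms)
  qed
  then show ?thesis
    unfolding eq A by blast
qed

text \<open>Index \<open>0 \<oplus>\<^sub>o 1\<close> is odd too, but its class is that of the
  closed sets, whence the separate hypothesis.\<close>

lemma F_Borel_Inter:
  assumes "odd_ord \<gamma>" "\<gamma> \<noteq> 0 \<oplus>\<^sub>o 1" "countable \<A>" "\<A> \<noteq> {}"
    and \<A>: "\<And>A. A \<in> \<A> \<Longrightarrow> \<exists>\<beta>. 0 < \<beta> \<and> \<beta> < \<gamma> \<and> A \<in> F_Borel Y \<beta>"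
  shows "\<Inter>\<A> \<in> F_Borel Y \<gamma>"
proof -
  have "\<gamma> \<noteq> 0"
    using assms(4) \<A> omega1_zero_le by (metis ex_in_conv leD)
  moreover have "\<not> even_ord \<gamma>"
    using assms(1) not_even_and_odd_ord by metis
  ultimately have eq: "F_Borel Y \<gamma> =
      {(\<Inter>n. A n) | A :: nat \<Rightarrow> 'a set. range A \<subseteq> (\<Union>\<beta>\<in>{0 \<oplus>\<^sub>o 1..<\<gamma>}. F_Borel Y \<beta>)}"
    using assms(2) by (subst F_Borel.simps) (simp only: if_False)
  obtain A :: "nat \<Rightarrow> 'a set" where A: "\<A> = range A"
    using range_from_nat_into[OF assms(4,3)] by metis
  have "range A \<subseteq> (\<Union>\<beta>\<in>{0 \<oplus>\<^sub>o 1..<\<gamma>}. F_Borel Y \<beta>)"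
  proof
    fix B assume "B \<in> range A"
    then obtain \<beta> where "0 < \<beta>" "\<beta> < \<gamma>" "B \<in> F_Borel Y \<beta>"
      using \<A>[of B] unfolding A by auto
    then show "B \<in> (\<Union>\<beta>\<in>{0 \<oplus>\<^sub>o 1..<\<gamma>}. F_Borel Y \<beta>)"
      by (intro UN_I[of \<beta>]) (simp_all only: atLeastLessThan_iff one_le_iff simp_thms)
  qed
  then show ?thesis
    unfolding eq A by blast
qed

text \<open>The truncated subtraction makes the levels \<open>0\<close> and \<open>1\<close> both closed.\<close>

definition hull_index :: "omega1 \<Rightarrow> nat \<Rightarrow> nat" where
  "hull_index \<mu> n = (if \<mu> = 0 then 2 * (n - 1) + 1 else 2 * n + 1)"

text \<open>The union over \<open>u\<close> raises an odd index to its even successor, and the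
  intersection over \<beta> and \<open>k\<close> needs an odd index above all of these. Thus each
  successor level costs two, while a limit level \<mu> only needs
  \<open>\<mu> \<oplus>\<^sub>o 1\<close>.\<close>

lemma tree_hull_in_F_Borel:
  assumes C: "\<And>s. closedin Y (C s)"
    and \<mu>: "\<mu> = 0 \<or> limit_ord \<mu>"
  shows "tree_hull C (\<mu> \<oplus>\<^sub>o n) s \<in> F_Borel Y (\<mu> \<oplus>\<^sub>o hull_index \<mu> n)"
  using \<mu>
proof (induction "\<mu> \<oplus>\<^sub>o n" arbitrary: \<mu> n s rule: less_induct)
  case less
  let ?\<alpha> = "\<mu> \<oplus>\<^sub>o n" and ?\<delta> = "\<mu> \<oplus>\<^sub>o hull_index \<mu> n"
  let ?U = "\<lambda>\<beta> k. \<Union>u\<in>{u. k \<le> length u}. tree_hull C \<beta> (s @ u)"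
  have "odd (hull_index \<mu> n)"
    by (simp add: hull_index_def)
  then have odd: "odd_ord ?\<delta>"
    using less.prems unfolding odd_ord_def by blast
  have U: "\<exists>\<gamma>. 0 < \<gamma> \<and> \<gamma> < ?\<delta> \<and> ?U \<beta> k \<in> F_Borel Y \<gamma>" if \<beta>: "0 < \<beta>" "\<beta> < ?\<alpha>" for \<beta> k
  proof -
    obtain \<nu> j where \<nu>: "\<nu> = 0 \<or> limit_ord \<nu>" "\<beta> = \<nu> \<oplus>\<^sub>o j"
      and less_\<delta>: "\<nu> \<oplus>\<^sub>o Suc (hull_index \<nu> j) < ?\<delta>"
      using \<beta>(2)
    proof (cases rule: less_oplus_cases)
      \<comment> \<open>\<beta> has its own decomposition with base below the limit \<mu>, and
        finite additions to that base stay below \<mu>.\<close>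
      case 1
      obtain \<nu> j where \<nu>: "\<nu> = 0 \<or> limit_ord \<nu>" "\<beta> = \<nu> \<oplus>\<^sub>o j"
        by (rule ord_decompose)
      have "limit_ord \<mu>"
        using 1 less.prems omega1_zero_le[of \<beta>] by auto
      moreover have "\<nu> < \<mu>"
        using 1 \<nu>(2) le_oplus[of \<nu> j] by simp
      ultimately have "\<nu> \<oplus>\<^sub>o Suc (hull_index \<nu> j) < \<mu>"
        by (rule limit_ord_oplus_less)
      with \<nu> that show ?thesis
        using le_oplus less_le_trans by blast
    next
      case (2 j)
      \<comment> \<open>Over base 0 the levels 0 and 1 share the index 1, so the strict inequality
        between indices would fail for \<open>j = 0\<close> and \<open>n = 1\<close>.\<close>
      have "j \<noteq> 0" if "\<mu> = 0"
        using \<beta>(1) 2(2) that by (cases j) auto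
      with 2(1) have "Suc (hull_index \<mu> j) < hull_index \<mu> n"
        by (auto simp: hull_index_def)
      with 2(2) less.prems that show ?thesis
        using oplus_strict_mono by blast
    qed
    have "?U \<beta> k \<in> F_Borel Y (\<nu> \<oplus>\<^sub>o Suc (hull_index \<nu> j))"
    proof (rule F_Borel_Union)
      have "even (Suc (hull_index \<nu> j))"
        by (simp add: hull_index_def)
      then show "even_ord (\<nu> \<oplus>\<^sub>o Suc (hull_index \<nu> j))"
        using \<nu>(1) unfolding even_ord_def by blast
      show "(\<lambda>u. tree_hull C \<beta> (s @ u)) ` {u. k \<le> length u} \<noteq> {}"
        using Ex_list_of_length[of k] by auto
      fix A assume "A \<in> (\<lambda>u. tree_hull C \<beta> (s @ u)) ` {u. k \<le> length u}"
      then obtain u where A: "A = tree_hull C \<beta> (s @ u)" by auto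
      have "A \<in> F_Borel Y (\<nu> \<oplus>\<^sub>o hull_index \<nu> j)"
        unfolding A \<nu>(2) using \<beta>(2) \<nu> by (intro less.hyps) auto
      moreover have "0 < \<nu> \<oplus>\<^sub>o hull_index \<nu> j"
        using oplus_strict_mono[of 0 "hull_index \<nu> j" \<nu>] omega1_zero_le[of \<nu>]
        by (auto simp: hull_index_def split: if_splits)
      moreover have "\<nu> \<oplus>\<^sub>o hull_index \<nu> j < \<nu> \<oplus>\<^sub>o Suc (hull_index \<nu> j)"
        by (rule oplus_strict_mono) simp
      ultimately show "\<exists>\<gamma>. 0 < \<gamma> \<and> \<gamma> < \<nu> \<oplus>\<^sub>o Suc (hull_index \<nu> j) \<and> A \<in> F_Borel Y \<gamma>"
        by blast
    qed auto
    moreover have "0 < \<nu> \<oplus>\<^sub>o Suc (hull_index \<nu> j)"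
      using oplus_strict_mono[of 0 "Suc (hull_index \<nu> j)" \<nu>] omega1_zero_le[of \<nu>]
      by (metis le_less_trans oplus_0 zero_less_Suc)
    ultimately show ?thesis
      using less_\<delta> by blast
  qed
  show ?case
  proof (cases "?\<delta> = 0 \<oplus>\<^sub>o 1")
    case True
    \<comment> \<open>Any level in this interval would give, by \<open>U\<close>, a positive index
      below 1. So the hull is just the closed set \<open>C s\<close>.\<close>
    have "{0<..<?\<alpha>} = {}"
    proof (rule ccontr)
      assume "{0<..<?\<alpha>} \<noteq> {}"
      then obtain \<beta> where "0 < \<beta>" "\<beta> < ?\<alpha>" by auto
      with U[of \<beta>] obtain \<gamma> where "0 < \<gamma>" "\<gamma> < ?\<delta>" by blast
      then show False
        unfolding True by (metis leD one_le_iff)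
    qed
    then have "tree_hull C ?\<alpha> s = C s"
      by (subst tree_hull.simps) simp
    then show ?thesis
      unfolding True by (simp add: F_Borel_closed[OF C, simplified])
  next
    case False
    let ?\<A> = "insert (C s) ((\<lambda>(\<beta>, k). ?U \<beta> k) ` ({0<..<?\<alpha>} \<times> UNIV))"
    have one_less: "0 \<oplus>\<^sub>o 1 < ?\<delta>"
    proof -
      have "0 < ?\<delta>"
        using oplus_strict_mono[of 0 "hull_index \<mu> n" \<mu>] omega1_zero_le[of \<mu>]
        by (auto simp: hull_index_def split: if_splits)
      with False show ?thesis
        using one_le_iff[of ?\<delta>] by auto
    qed
    have "\<Inter>?\<A> \<in> F_Borel Y ?\<delta>"
    proof (rule F_Borel_Inter[OF odd False])
      have "countable {0<..<?\<alpha>}"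
        by (rule countable_subset[OF _ countable_below[of ?\<alpha>]]) auto
      then show "countable ?\<A>" by simp
      fix A assume "A \<in> ?\<A>"
      then consider "A = C s" | \<beta> k where "0 < \<beta>" "\<beta> < ?\<alpha>" "A = ?U \<beta> k" by auto
      then show "\<exists>\<beta>. 0 < \<beta> \<and> \<beta> < ?\<delta> \<and> A \<in> F_Borel Y \<beta>"
      proof cases
        case 1
        then show ?thesis
          using F_Borel_closed[OF C[of s]] one_less one_le_iff by blast
      next
        case 2
        then show ?thesis using U by blast
      qed
    qed simp
    moreover have "\<Inter>?\<A> = tree_hull C ?\<alpha> s"
      by (subst tree_hull.simps) auto
    ultimately show ?thesis by simp
  qed
qed


section \<open>The hulls of cylinders in an extension\<close>

text \<open>At every level, take for \<open>u\<close> the next \<open>k\<close> entries of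
  \<sigma>.\<close>

lemma in_tree_hull_of_cylinder:
  assumes "\<And>\<sigma> s. \<sigma> \<in> cylinder s \<Longrightarrow> g \<sigma> \<in> C s" "\<sigma> \<in> cylinder s"
  shows "g \<sigma> \<in> tree_hull C \<alpha> s"
  using assms(2)
proof (induction \<alpha> arbitrary: s rule: less_induct)
  case (less \<alpha>)
  have "\<exists>u. k \<le> length u \<and> g \<sigma> \<in> tree_hull C \<beta> (s @ u)" if "\<beta> < \<alpha>" for \<beta> k
    using less.IH[OF that cylinder_append_map[OF less.prems, of k]]
    by (intro exI[of _ "map \<sigma> [length s..<length s + k]"]) simp
  then show ?case
    using assms(1)[OF less.prems] by (subst tree_hull.simps) auto
qed

text \<open>Meant for the image of \<infinity>, which was added to every \<open>C s\<close>; any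
  \<open>u\<close> of length \<open>k\<close> will do.\<close>

lemma in_tree_hull_const:
  assumes "\<And>s. x \<in> C s"
  shows "x \<in> tree_hull C \<alpha> s"
proof (induction \<alpha> arbitrary: s rule: less_induct)
  case (less \<alpha>)
  have "\<exists>u. k \<le> length u \<and> x \<in> tree_hull C \<beta> (s @ u)" if "\<beta> < \<alpha>" for \<beta> k
    using less.IH[OF that] Ex_list_of_length[of k] by (metis order_refl)
  then show ?case
    using assms by (subst tree_hull.simps) auto
qed

text \<open>Induction on the level, with \<open>V\<close> fixed and \<open>s\<close> growing: the
  brooms covering the trace of \<open>V\<close> on the cylinder always have rank below the current
  level. Finiteness of \<F> gives a largest rank \<beta> below \<alpha>, and passing to the hull at
  level \<beta> pushes all ranks below \<beta>.\<close>

lemma tree_hull_subset_range: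
  assumes Y: "Hausdorff_space Y" and g: "range g \<subseteq> topspace Y"
    and C: "\<And>s. C s = insert p (Y closure_of (g ` cylinder s))"
    and V: "openin Y V" "y \<in> V" and "y \<noteq> p"
    and y: "y \<in> tree_hull C \<alpha> s"
    and \<F>: "finite \<F>" "\<F> \<subseteq> (\<Union>\<beta>\<in>{..<\<alpha>}. broom_ext \<beta>)"
    and sub: "{\<sigma> \<in> cylinder s. g \<sigma> \<in> V} \<subseteq> \<Union>\<F>"
  shows "y \<in> range g"
  using y \<F> sub
proof (induction \<alpha> arbitrary: s \<F> rule: less_induct)
  case (less \<alpha>)
  have "y \<in> C s"
    using less.prems(1) by (subst (asm) tree_hull.simps) auto
  then have "y \<in> Y closure_of (g ` cylinder s)"
    using \<open>y \<noteq> p\<close> by (simp add: C)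
  then have "y \<in> V \<inter> Y closure_of (g ` cylinder s)"
    using V by simp
  then have cl: "y \<in> Y closure_of (V \<inter> g ` cylinder s)"
    using openin_Int_closure_of_subset[OF V(1)] by blast
  obtain r where r: "\<And>E. E \<in> \<F> \<Longrightarrow> r E < \<alpha> \<and> E \<in> broom_ext (r E)"
    using less.prems(3) by (metis UN_E lessThan_iff subsetD)
  show ?case
  proof (cases "\<forall>E\<in>\<F>. r E = 0")
    \<comment> \<open>This covers empty \<F>, hence also \<alpha> = 0. The trace is finite, so its
      image is closed in a Hausdorff space and contains \<open>y\<close>.\<close>
    case True
    then have "finite (\<Union>\<F>)"
      using less.prems(2) r broom_ext_0_finite by (metis finite_Union)
    then have "finite {\<sigma> \<in> cylinder s. g \<sigma> \<in> V}"
      using less.prems(4) finite_subset by blast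
    moreover have "V \<inter> g ` cylinder s = g ` {\<sigma> \<in> cylinder s. g \<sigma> \<in> V}"
      by auto
    ultimately have "closedin Y (V \<inter> g ` cylinder s)"
      using g by (intro closedin_Hausdorff_finite[OF Y]) auto
    with cl show ?thesis
      by (auto simp: closure_of_closedin)
  next
    case False
    then have ne: "\<F> \<noteq> {}" by auto
    define \<beta> where "\<beta> = Max (r ` \<F>)"
    have r_le: "r E \<le> \<beta>" if "E \<in> \<F>" for E
      using that less.prems(2) by (simp add: \<beta>_def)
    have "\<beta> \<in> r ` \<F>"
      using less.prems(2) ne by (simp add: \<beta>_def)
    then have "\<beta> < \<alpha>" using r by auto
    have "0 < \<beta>"
    proof -
      obtain E where "E \<in> \<F>" "r E \<noteq> 0" using False by auto
      then show ?thesis using r_le[of E] omega1_zero_le[of "r E"] by auto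
    qed
    have "\<exists>k. \<forall>t. k \<le> length t \<longrightarrow> (\<exists>\<gamma><\<beta>. \<exists>E'\<in>broom_ext \<gamma>. E \<inter> cylinder t \<subseteq> E')"
      if "E \<in> \<F>" for E
    proof -
      have "E \<in> broom_ext \<beta>"
        using r[OF that] r_le[OF that] broom_ext_mono by blast
      then show ?thesis
        using broom_ext_cylinder[OF _ \<open>0 < \<beta>\<close>] by metis
    qed
    then obtain k where k: "\<And>E t. E \<in> \<F> \<Longrightarrow> k E \<le> length t \<Longrightarrow>
        \<exists>\<gamma><\<beta>. \<exists>E'\<in>broom_ext \<gamma>. E \<inter> cylinder t \<subseteq> E'"
      by metis
    \<comment> \<open>With the maximum of the thresholds, one \<open>u\<close> is long enough for
      all brooms in \<F> at once.\<close>
    have "y \<in> (\<Union>u\<in>{u. Max (k ` \<F>) \<le> length u}. tree_hull C \<beta> (s @ u))"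
      using less.prems(1) \<open>0 < \<beta>\<close> \<open>\<beta> < \<alpha>\<close> by (subst (asm) tree_hull.simps) auto
    then obtain u where u: "Max (k ` \<F>) \<le> length u" "y \<in> tree_hull C \<beta> (s @ u)"
      by auto
    have "k E \<le> length (s @ u)" if "E \<in> \<F>" for E
      using u(1) that less.prems(2) ne by (simp add: trans_le_add2)
    then have "\<forall>E\<in>\<F>. \<exists>E'. (\<exists>\<gamma><\<beta>. E' \<in> broom_ext \<gamma>) \<and> E \<inter> cylinder (s @ u) \<subseteq> E'"
      using k by meson
    then obtain c where c: "\<And>E. E \<in> \<F> \<Longrightarrow> \<exists>\<gamma><\<beta>. c E \<in> broom_ext \<gamma>"
      "\<And>E. E \<in> \<F> \<Longrightarrow> E \<inter> cylinder (s @ u) \<subseteq> c E"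
      by metis
    show ?thesis
    proof (rule less.IH[OF \<open>\<beta> < \<alpha>\<close> u(2), of "c ` \<F>"])
      show "finite (c ` \<F>)" using less.prems(2) by simp
      show "c ` \<F> \<subseteq> (\<Union>\<beta>\<in>{..<\<beta>}. broom_ext \<beta>)" using c(1) by auto
      show "{\<sigma> \<in> cylinder (s @ u). g \<sigma> \<in> V} \<subseteq> \<Union>(c ` \<F>)"
        using c(2) less.prems(4) cylinder_append_subset[of s u] by fastforce
    qed
  qed
qed

text \<open>The image of the space equals the hull of the empty sequence at level
  \<open>\<mu> \<oplus>\<^sub>o n\<close>, so the index computed for hulls applies.\<close>

lemma broom_space_absolutely_F:
  fixes \<E> :: "(nat \<Rightarrow> nat) set set"
  assumes \<mu>: "\<mu> = 0 \<or> limit_ord \<mu>"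
    and \<E>: "\<E> \<subseteq> (\<Union>\<beta>\<in>{..<\<mu> \<oplus>\<^sub>o n}. broom_ext \<beta>)"
  shows "absolutely_F TYPE('b) (broom_space \<E>) (\<mu> \<oplus>\<^sub>o hull_index \<mu> n)"
  unfolding absolutely_F_def
proof (intro allI impI, elim conjE)
  fix Y :: "'b topology" and e
  assume Y: "tychonoff_space Y" and e: "embedding_map (broom_space \<E>) Y e"
  have Haus: "Hausdorff_space Y"
    using Y by (simp add: tychonoff_space_def)
  have hom: "homeomorphic_map (broom_space \<E>) (subtopology Y (range e)) e"
    using e by (simp add: embedding_map_def topspace_broom_space)
  have sub: "range e \<subseteq> topspace Y"
    using homeomorphic_imp_surjective_map[OF hom]
    by (metis inf_le1 topspace_broom_space topspace_subtopology)
  define g where "g = e \<circ> Some"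
  define C where "C s = insert (e None) (Y closure_of (g ` cylinder s))" for s
  have g: "range g \<subseteq> topspace Y"
    using sub by (auto simp: g_def)
  have closed: "closedin Y (C s)" for s
  proof -
    have "closedin Y {e None}"
      using sub by (intro closedin_Hausdorff_singleton[OF Haus]) auto
    then have "closedin Y ({e None} \<union> Y closure_of (g ` cylinder s))"
      by (intro closedin_Un) auto
    then show ?thesis by (simp add: C_def)
  qed
  have in_C: "g \<sigma> \<in> C s" if "\<sigma> \<in> cylinder s" for \<sigma> s
  proof -
    have "g ` cylinder s \<subseteq> Y closure_of (g ` cylinder s)"
      using g by (intro closure_of_subset) auto
    with that show ?thesis by (auto simp: C_def)
  qed
  have "range e = tree_hull C (\<mu> \<oplus>\<^sub>o n) []"
  proof
    show "range e \<subseteq> tree_hull C (\<mu> \<oplus>\<^sub>o n) []"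
    proof (intro image_subsetI)
      fix x
      show "e x \<in> tree_hull C (\<mu> \<oplus>\<^sub>o n) []"
      proof (cases x)
        case None
        then show ?thesis
          using in_tree_hull_const[of "e None" C] by (simp add: C_def)
      next
        case (Some \<sigma>)
        then show ?thesis
          using in_tree_hull_of_cylinder[of g C \<sigma> "[]"] in_C by (simp add: g_def cylinder_def)
      qed
    qed
    show "tree_hull C (\<mu> \<oplus>\<^sub>o n) [] \<subseteq> range e"
    proof
      fix y assume y: "y \<in> tree_hull C (\<mu> \<oplus>\<^sub>o n) []"
      show "y \<in> range e"
      proof (cases "y = e None")
        case False
        have "y \<in> topspace Y"
          using y closedin_subset[OF closed[of "[]"]] by (subst (asm) tree_hull.simps) auto
        moreover have "e None \<in> topspace Y"
          using sub by auto
        ultimately obtain V W where VW: "openin Y V" "openin Y W" "y \<in> V" "e None \<in> W" "disjnt V W"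
          using Haus False by (meson Hausdorff_space_def)
        have "continuous_map (broom_space \<E>) Y e"
          using homeomorphic_imp_continuous_map[OF hom] by (rule continuous_map_into_fulltopology)
        then have "openin (broom_space \<E>) {x \<in> topspace (broom_space \<E>). e x \<in> W}"
          using VW(2) by (rule openin_continuous_map_preimage)
        then have "openin (broom_space \<E>) {x. e x \<in> W}"
          by (simp add: topspace_broom_space)
        then obtain \<F> where \<F>: "finite \<F>" "\<F> \<subseteq> \<E>" "{None} \<union> Some ` (UNIV - \<Union>\<F>) \<subseteq> {x. e x \<in> W}"
          using VW(4) unfolding openin_broom_space_iff by auto
        \<comment> \<open>\<open>W\<close> contains the images of all sequences outside the union of
          \<F>, and \<open>V\<close> misses \<open>W\<close>.\<close>
        have "{\<sigma> \<in> cylinder []. g \<sigma> \<in> V} \<subseteq> \<Union>\<F>"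
          using \<F>(3) VW(5) unfolding g_def disjnt_iff by fastforce
        then have "y \<in> range g"
          by (rule tree_hull_subset_range[OF Haus g C_def VW(1,3) False y \<F>(1) order_trans[OF \<F>(2) \<E>]])
        then show ?thesis by (auto simp: g_def)
      qed simp
    qed
  qed
  then show "e ` topspace (broom_space \<E>) \<in> F_Borel Y (\<mu> \<oplus>\<^sub>o hull_index \<mu> n)"
    using tree_hull_in_F_Borel[of Y C \<mu> n "[]", OF closed \<mu>] by (simp add: topspace_broom_space)
qed

theorem proposition5p13:
  fixes m :: nat and \<mu> :: omega1 and \<E> :: "(nat \<Rightarrow> nat) set set"
  assumes "limit_ord \<mu>"
    and "\<E> \<subseteq> infinite_broom_sets"
    and "tychonoff_space (broom_space \<E>)"
  shows "(\<E> \<subseteq> broom_ext (0 \<oplus>\<^sub>o m) \<longrightarrow>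
            absolutely_F TYPE('b) (broom_space \<E>) (0 \<oplus>\<^sub>o (2 * m + 1))) \<and>
         (\<E> \<subseteq> (\<Union>\<beta>\<in>{..<\<mu>}. broom_ext \<beta>) \<longrightarrow>
            absolutely_F TYPE('b) (broom_space \<E>) (\<mu> \<oplus>\<^sub>o 1)) \<and>
         (\<E> \<subseteq> broom_ext (\<mu> \<oplus>\<^sub>o m) \<longrightarrow>
            absolutely_F TYPE('b) (broom_space \<E>) (\<mu> \<oplus>\<^sub>o (2 * m + 3)))"
proof (intro conjI impI)
  \<comment> \<open>The general bound wants ranks strictly below the level, so the first and third
    claims use level \<open>Suc m\<close>, where \<open>hull_index\<close> is
    \<open>2 * m + 1\<close> over base 0 and \<open>2 * m + 3\<close> over a limit. The second is
    strict already and uses level 0 over \<mu>.\<close>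
  have below: "broom_ext \<alpha> \<subseteq> (\<Union>\<beta>\<in>{..<osuc \<alpha>}. broom_ext \<beta>)" for \<alpha>
    using less_osuc by blast
  have \<mu>: "\<mu> \<noteq> 0"
    using assms(1) by (simp add: limit_ord_def)
  {
    assume "\<E> \<subseteq> broom_ext (0 \<oplus>\<^sub>o m)"
    then have "\<E> \<subseteq> (\<Union>\<beta>\<in>{..<0 \<oplus>\<^sub>o Suc m}. broom_ext \<beta>)"
      using below by (metis oplus_Suc order_trans)
    from broom_space_absolutely_F[OF _ this]
    show "absolutely_F TYPE('b) (broom_space \<E>) (0 \<oplus>\<^sub>o (2 * m + 1))"
      by (simp add: hull_index_def)
  next
    assume "\<E> \<subseteq> (\<Union>\<beta>\<in>{..<\<mu>}. broom_ext \<beta>)"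
    then show "absolutely_F TYPE('b) (broom_space \<E>) (\<mu> \<oplus>\<^sub>o 1)"
      using broom_space_absolutely_F[of \<mu> \<E> 0] assms(1) \<mu> by (simp add: hull_index_def)
  next
    assume "\<E> \<subseteq> broom_ext (\<mu> \<oplus>\<^sub>o m)"
    then have "\<E> \<subseteq> (\<Union>\<beta>\<in>{..<\<mu> \<oplus>\<^sub>o Suc m}. broom_ext \<beta>)"
      using below by (metis oplus_Suc order_trans)
    from broom_space_absolutely_F[OF _ this]
    show "absolutely_F TYPE('b) (broom_space \<E>) (\<mu> \<oplus>\<^sub>o (2 * m + 3))"
      using assms(1) \<mu> by (simp add: hull_index_def eval_nat_numeral)
  }
qed

end
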